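(* Let $n\geq 2$, let $S_n$ be either $\Sigma_n$ or $\Sigma_n^{*}$, and let $\ell\geq 0$ be an integer. Then \[ s(B_n,S_n;\ell)=\sum_{t\in R_n(S_n,\ell)} \mathrm{card}\left(B_n(S_n,\ell,t)\right)\cdot \mathrm{card}\left(G_{S_n}\star t\right). \]
   Context: $B_n$ is the braid group, generated by $\sigma_1,\ldots,\sigma_{n-1}$ subject to $\sigma_i\sigma_j=\sigma_j\sigma_i$ for $|i-j|\geq 2$ and $\sigma_i\sigma_j\sigma_i=\sigma_j\sigma_i\sigma_j$ for $|i-j|=1$. Put $\Sigma_n=\{\sigma_i^{\pm1}\}$. For $1\leq p<q\leq n$ put $a_{p,q}=\sigma_p\cdots\sigma_{q-2}\,\sigma_{q-1}\,\sigma_{q-2}^{-1}\cdots\sigma_p^{-1}$, with the convention $a_{q,p}=a_{p,q}$, and $\Sigma_n^{*}=\{a_{p,q}^{\pm1}: 1\leq p<q\leq n\}$. An $S_n$-word is a finite word on the alphabet $S_n$; $\overline{u}$ is the braid represented by $u$; $|\beta|_{S_n}$ is the length of a shortest $S_n$-word representing $\beta$; $B_n(S_n,\ell)$ is the set of braids of $S_n$-length $\ell$, and $s(B_n,S_n;\ell)=\mathrm{card}(B_n(S_n,\ell))$. Permutation: $\pi:B_n\to\mathfrak{S}_n$ is the homomorphism to $(\mathfrak{S}_n,\circ)$ with $\pi(\sigma_i)=(i\ \,i{+}1)$. Linking numbers: for $i\neq j$ in $\{1,\ldots,n\}$, $\ell_{i,j}(\beta)=\ell_{j,i}(\beta)$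 is the algebraic number of crossings ($\sigma_k$ counts $+1$, $\sigma_k^{-1}$ counts $-1$) in $\beta$ between the strands starting at positions $i$ and $j$; explicitly, if $\beta=\sigma_{k_1}^{e_1}\cdots\sigma_{k_r}^{e_r}$ and $\beta_{m}=\sigma_{k_1}^{e_1}\cdots\sigma_{k_m}^{e_m}$, then $\ell_{i,j}(\beta)$ is the sum of $e_m$ over those $m$ with $\{\pi(\beta_{m-1})(k_m),\pi(\beta_{m-1})(k_m+1)\}=\{i,j\}$ (independent of the chosen word). Template: $\tau(\beta)=(\pi(\beta),\ell_{1,2}(\beta),\ell_{1,3}(\beta),\ell_{2,3}(\beta),\ldots,\ell_{1,n}(\beta),\ldots,\ell_{n-1,n}(\beta))\in\mathfrak{S}_n\times\mathbb{Z}^{n(n-1)/2}$, the linking numbers $\ell_{i,j}$, $i<j$, being listed in co-lexicographic order of indices ($(i,j)$ before $(p,q)$ if $j<q$, or $j=q$ and $i<p$). $T_n=\tau(B_n)$, $T_n(S_n,\ell)=\tau(B_n(S_n,\ell))$, and $B_n(S_n,\ell,t)=\{\beta\in B_n(S_n,\ell):\tau(\beta)=t\}$. Action: consider the following maps on words. $\mathrm{inv}_{S_n}(x_1\cdots x_r)=x_r^{-1}\cdots x_1^{-1}$ on $S_n$-words; $\theta_{\Sigma_n}(x_1\cdots x_r)=x_1^{-1}\cdots x_r^{-1}$ on $\Sigma_n$-words; $\Phi_n$ on $\Sigma_n$-words, the letterwise map $\sigma_k^{\pm1}\mapsto\sigma_{n-k}^{\pm1}$; $\phi_n$ on $\Sigma_n^{*}$-words,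 the letterwise map $a_{p,q}^{\pm1}\mapsto a_{[p+1]_n,[q+1]_n}^{\pm1}$, where $[k]_n=k$ for $1\leq k\leq n$ and $[n+1]_n=1$. For each of these maps $\mu$, the template $\tau(\overline{\mu(u)})$ depends only on $\tau(\overline{u})$, and $\mu^T:T_n\to T_n$ denotes the induced bijection, $\mu^T(\tau(\overline{u}))=\tau(\overline{\mu(u)})$. $G_{\Sigma_n}$ is the group of bijections of $T_n$ generated by $\mathrm{inv}_{\Sigma_n}^T,\theta_{\Sigma_n}^T,\Phi_n^T$, and $G_{\Sigma_n^{*}}$ the one generated by $\mathrm{inv}_{\Sigma_n^{*}}^T,\phi_n^T$. $G_{S_n}\star t=\{g(t):g\in G_{S_n}\}$ is the orbit of $t$. Reduced templates: for $\sigma,\sigma'\in\mathfrak{S}_n$ write $\sigma<\sigma'$ if there is $k$ with $\sigma(m)=\sigma'(m)$ for all $m>k$ and $\sigma(k)<\sigma'(k)$. Templates are totally ordered lexicographically as tuples (first the permutation with this order, then the linking numbers in the order listed above). $\mathrm{red}_{S_n}(t)$ is the minimal element of $G_{S_n}\star t$; $t$ is $S_n$-reduced if $\mathrm{red}_{S_n}(t)=t$. $R_n(S_n,\ell)$ is the set of $S_n$-reduced templates lying in $T_n(S_n,\ell)$. *)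

theory Defs
  imports "HOL-Algebra.Bij" "HOL-Algebra.Generated_Groups" "HOL-Combinatorics.Transposition"
begin

section \<open>The braid group\<close>

text \<open>
  A signed letter \<open>(x, True)\<close> stands for \<open>x\<close> and \<open>(x, False)\<close> for \<open>x\<inverse>\<close>. The group \<open>B\<^sub>n\<close> is
  the quotient of the words in \<open>\<sigma>\<^sub>1, \<dots>, \<sigma>\<^bsub>n-1\<^esub>\<close> and their formal inverses by the congruence
  generated by free cancellation and the braid relations, so a braid is a class of words.
\<close>

definition inv_letter :: "'a \<times> bool \<Rightarrow> 'a \<times> bool" where
  "inv_letter = (\<lambda>(x, e). (x, \<not> e))"

type_synonym artin_word = "(nat \<times> bool) list"
type_synonym braid = "artin_word set"

definition artin_words :: "nat \<Rightarrow> artin_word set" where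
  "artin_words n = lists ({1..<n} \<times> UNIV)"

inductive_set braid_rel :: "nat \<Rightarrow> (artin_word \<times> artin_word) set" for n :: nat where
  refl: "u \<in> artin_words n \<Longrightarrow> (u, u) \<in> braid_rel n"
| sym: "(u, v) \<in> braid_rel n \<Longrightarrow> (v, u) \<in> braid_rel n"
| trans: "(u, v) \<in> braid_rel n \<Longrightarrow> (v, w) \<in> braid_rel n \<Longrightarrow> (u, w) \<in> braid_rel n"
| cancel: "u \<in> artin_words n \<Longrightarrow> v \<in> artin_words n \<Longrightarrow> i \<in> {1..<n} \<Longrightarrow>
    (u @ [(i, e), (i, \<not> e)] @ v, u @ v) \<in> braid_rel n"
| commute: "u \<in> artin_words n \<Longrightarrow> v \<in> artin_words n \<Longrightarrow> i \<in> {1..<n} \<Longrightarrow> j \<in> {1..<n} \<Longrightarrow>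
    \<bar>int i - int j\<bar> \<ge> 2 \<Longrightarrow>
    (u @ [(i, True), (j, True)] @ v, u @ [(j, True), (i, True)] @ v) \<in> braid_rel n"
| braid: "u \<in> artin_words n \<Longrightarrow> v \<in> artin_words n \<Longrightarrow> i \<in> {1..<n} \<Longrightarrow> j \<in> {1..<n} \<Longrightarrow>
    \<bar>int i - int j\<bar> = 1 \<Longrightarrow>
    (u @ [(i, True), (j, True), (i, True)] @ v,
     u @ [(j, True), (i, True), (j, True)] @ v) \<in> braid_rel n"

definition braid_class :: "nat \<Rightarrow> artin_word \<Rightarrow> braid" where
  "braid_class n w = braid_rel n `` {w}"

definition braid_group :: "nat \<Rightarrow> braid monoid" where
  "braid_group n =
     \<lparr>carrier = artin_words n // braid_rel n,
      mult = (\<lambda>A B. \<Union>u\<in>A. \<Union>v\<in>B. braid_class n (u @ v)),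
      one = braid_class n []\<rparr>"


section \<open>The two generating alphabets\<close>

datatype alphabet = Artin | Dual

text \<open>\<open>Sig k\<close> names \<open>\<sigma>\<^sub>k\<close>, and \<open>Band p q\<close> with \<open>p < q\<close> names the band generator \<open>a\<^bsub>p,q\<^esub>\<close>.\<close>

datatype gen = Sig nat | Band nat nat

type_synonym letter = "gen \<times> bool"

fun gens :: "nat \<Rightarrow> alphabet \<Rightarrow> gen set" where
  "gens n Artin = {Sig k |k. 1 \<le> k \<and> k < n}"
| "gens n Dual = {Band p q |p q. 1 \<le> p \<and> p < q \<and> q \<le> n}"

definition words :: "nat \<Rightarrow> alphabet \<Rightarrow> letter list set" where
  "words n S = lists (gens n S \<times> UNIV)"

fun gen_braid :: "nat \<Rightarrow> gen \<Rightarrow> braid" where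
  "gen_braid n (Sig k) = braid_class n [(k, True)]"
| "gen_braid n (Band p q) = braid_class n
     (map (\<lambda>k. (k, True)) [p..<q - 1] @ [(q - 1, True)] @ map (\<lambda>k. (k, False)) (rev [p..<q - 1]))"

definition letter_braid :: "nat \<Rightarrow> letter \<Rightarrow> braid" where
  "letter_braid n = (\<lambda>(g, e). if e then gen_braid n g else inv\<^bsub>braid_group n\<^esub> gen_braid n g)"

definition word_braid :: "nat \<Rightarrow> letter list \<Rightarrow> braid" where
  "word_braid n w = foldr (\<lambda>x \<beta>. letter_braid n x \<otimes>\<^bsub>braid_group n\<^esub> \<beta>) w \<one>\<^bsub>braid_group n\<^esub>"

definition braid_length :: "nat \<Rightarrow> alphabet \<Rightarrow> braid \<Rightarrow> nat" where
  "braid_length n S \<beta> = (LEAST r. \<exists>w\<in>words n S. word_braid n w = \<beta> \<and> length w = r)"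

definition braids_of_length :: "nat \<Rightarrow> alphabet \<Rightarrow> nat \<Rightarrow> braid set" where
  "braids_of_length n S l = {\<beta> \<in> carrier (braid_group n). braid_length n S \<beta> = l}"

definition num_braids :: "nat \<Rightarrow> alphabet \<Rightarrow> nat \<Rightarrow> nat" where
  "num_braids n S l = card (braids_of_length n S l)"


section \<open>Templates\<close>

definition word_perm :: "artin_word \<Rightarrow> nat \<Rightarrow> nat" where
  "word_perm w = foldr (\<lambda>(k, e) f. transpose k (Suc k) \<circ> f) w id"

text \<open>The strand in position \<open>k\<close> after the prefix \<open>u\<close> is the one that started at \<open>word_perm u k\<close>.\<close>

definition word_linking :: "nat \<Rightarrow> nat \<Rightarrow> artin_word \<Rightarrow> int" where
  "word_linking i j w =
     (\<Sum>m<length w. let (k, e) = w ! m; f = word_perm (take m w) in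
        if {f k, f (Suc k)} = {i, j} then (if e then 1 else -1) else 0)"

text \<open>Both invariants are constant on each class of words; \<open>the_elem\<close> picks the common value.\<close>

definition braid_perm :: "braid \<Rightarrow> nat \<Rightarrow> nat" where
  "braid_perm \<beta> = the_elem (word_perm ` \<beta>)"

definition linking :: "nat \<Rightarrow> nat \<Rightarrow> braid \<Rightarrow> int" where
  "linking i j \<beta> = the_elem (word_linking i j ` \<beta>)"

type_synonym tmpl = "(nat \<Rightarrow> nat) \<times> int list"

definition template :: "nat \<Rightarrow> braid \<Rightarrow> tmpl" where
  "template n \<beta> =
     (braid_perm \<beta>, concat (map (\<lambda>j. map (\<lambda>i. linking i j \<beta>) [1..<j]) [2..<Suc n]))"

definition templates :: "nat \<Rightarrow> tmpl set" where
  "templates n = template n ` carrier (braid_group n)"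

definition templates_of_length :: "nat \<Rightarrow> alphabet \<Rightarrow> nat \<Rightarrow> tmpl set" where
  "templates_of_length n S l = template n ` braids_of_length n S l"

definition braids_of_template :: "nat \<Rightarrow> alphabet \<Rightarrow> nat \<Rightarrow> tmpl \<Rightarrow> braid set" where
  "braids_of_template n S l t = {\<beta> \<in> braids_of_length n S l. template n \<beta> = t}"


section \<open>Symmetries acting on templates\<close>

definition inv_word :: "letter list \<Rightarrow> letter list" where
  "inv_word w = rev (map inv_letter w)"

definition theta_word :: "letter list \<Rightarrow> letter list" where
  "theta_word w = map inv_letter w"

text \<open>
  The next two maps act on Artin words and on dual words, respectively. Their values on
  generators of the other alphabet are arbitrary.
\<close>

fun flip_gen :: "nat \<Rightarrow> gen \<Rightarrow> gen" where
  "flip_gen n (Sig k) = Sig (n - k)"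
| "flip_gen n (Band p q) = Band p q"

definition Phi_word :: "nat \<Rightarrow> letter list \<Rightarrow> letter list" where
  "Phi_word n w = map (apfst (flip_gen n)) w"

definition cyc :: "nat \<Rightarrow> nat \<Rightarrow> nat" where
  "cyc n k = (if k = Suc n then 1 else k)"

text \<open>\<open>min\<close> and \<open>max\<close> implement the convention that \<open>a\<^bsub>q,p\<^esub>\<close> equals \<open>a\<^bsub>p,q\<^esub>\<close>.\<close>

fun rotate_gen :: "nat \<Rightarrow> gen \<Rightarrow> gen" where
  "rotate_gen n (Sig k) = Sig k"
| "rotate_gen n (Band p q) =
     (let p' = cyc n (p + 1); q' = cyc n (q + 1) in Band (min p' q') (max p' q'))"

definition phi_word :: "nat \<Rightarrow> letter list \<Rightarrow> letter list" where
  "phi_word n w = map (apfst (rotate_gen n)) w"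

text \<open>
  The description below determines a value only because the template of \<open>\<mu> w\<close> depends only on
  that of \<open>w\<close>. The restriction makes the map an element of \<open>BijGroup (templates n)\<close>.
\<close>

definition induced ::
  "nat \<Rightarrow> alphabet \<Rightarrow> (letter list \<Rightarrow> letter list) \<Rightarrow> tmpl \<Rightarrow> tmpl" where
  "induced n S \<mu> = (\<lambda>t\<in>templates n. THE t'.
     \<exists>w\<in>words n S. template n (word_braid n w) = t \<and> template n (word_braid n (\<mu> w)) = t')"

fun symmetry_gens :: "nat \<Rightarrow> alphabet \<Rightarrow> (tmpl \<Rightarrow> tmpl) set" where
  "symmetry_gens n Artin =
     {induced n Artin inv_word, induced n Artin theta_word, induced n Artin (Phi_word n)}"
| "symmetry_gens n Dual = {induced n Dual inv_word, induced n Dual (phi_word n)}"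

definition symmetries :: "nat \<Rightarrow> alphabet \<Rightarrow> (tmpl \<Rightarrow> tmpl) set" where
  "symmetries n S = generate (BijGroup (templates n)) (symmetry_gens n S)"

definition template_orbit :: "nat \<Rightarrow> alphabet \<Rightarrow> tmpl \<Rightarrow> tmpl set" where
  "template_orbit n S t = {g t |g. g \<in> symmetries n S}"


section \<open>Reduced templates\<close>

definition perm_less :: "nat \<Rightarrow> (nat \<Rightarrow> nat) \<Rightarrow> (nat \<Rightarrow> nat) \<Rightarrow> bool" where
  "perm_less n f g \<longleftrightarrow> (\<exists>k\<in>{1..n}. (\<forall>m\<in>{k<..n}. f m = g m) \<and> f k < g k)"

definition template_less :: "nat \<Rightarrow> tmpl \<Rightarrow> tmpl \<Rightarrow> bool" where
  "template_less n t t' \<longleftrightarrow>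
     perm_less n (fst t) (fst t') \<or>
     fst t = fst t' \<and> (snd t, snd t') \<in> lexord {(x, y). x < y}"

definition red :: "nat \<Rightarrow> alphabet \<Rightarrow> tmpl \<Rightarrow> tmpl" where
  "red n S t = (THE u. u \<in> template_orbit n S t \<and>
     (\<forall>v\<in>template_orbit n S t. v = u \<or> template_less n u v))"

definition reduced_templates :: "nat \<Rightarrow> alphabet \<Rightarrow> nat \<Rightarrow> tmpl set" where
  "reduced_templates n S l = {t \<in> templates_of_length n S l. red n S t = t}"

end

(*
  Each of the word maps inv, theta, Phi, phi is a length-preserving bijection of the words that
  descends to a bijection M of the braid group: inversion, two automorphisms given on Artin words,
  and conjugation by sigma_1 ... sigma_(n-1). The cocycle formula for linking numbers shows that M
  respects equality of templates in both directions, so M maps the length-l braids with template t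
  bijectively onto those with template mu^T(t). Hence the number of length-l braids with a given
  template is constant on orbits, and the length-l templates form a finite union of orbits, each
  containing exactly one reduced template.
*)
theory Submission imports Defs
begin

section \<open>The braid group is a group\<close>

lemma artin_words_simps [simp]:
  "[] \<in> artin_words n"
  "(k, e) # w \<in> artin_words n \<longleftrightarrow> 1 \<le> k \<and> k < n \<and> w \<in> artin_words n"
  "u @ v \<in> artin_words n \<longleftrightarrow> u \<in> artin_words n \<and> v \<in> artin_words n"
  "rev w \<in> artin_words n \<longleftrightarrow> w \<in> artin_words n"
  by (auto simp: artin_words_def in_lists_conv_set)

lemma map_artin_words_iff:
  "map (\<lambda>k. (k, e)) ks \<in> artin_words n \<longleftrightarrow> set ks \<subseteq> {1..<n}"
  by (auto simp: artin_words_def in_lists_conv_set)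

lemma inv_letter_simps [simp]:
  "inv_letter (x, e) = (x, \<not> e)" "inv_letter (inv_letter y) = y"
  by (auto simp: inv_letter_def split: prod.splits)

lemma inv_letter_apfst: "inv_letter (apfst f x) = apfst f (inv_letter x)"
  by (cases x) simp

lemma map_inv_letter_artin_words [simp]:
  "map inv_letter w \<in> artin_words n \<longleftrightarrow> w \<in> artin_words n"
  by (induction w) auto

lemma braid_rel_artin_words:
  "(u, v) \<in> braid_rel n \<Longrightarrow> u \<in> artin_words n \<and> v \<in> artin_words n"
  by (induction rule: braid_rel.induct) (simp_all add: Suc_le_eq)

lemma equiv_braid_rel: "equiv (artin_words n) (braid_rel n)"
  unfolding equiv_def refl_on_def sym_def trans_def
  using braid_rel_artin_words braid_rel.refl braid_rel.sym braid_rel.trans by fast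

lemma braid_class_eq_iff:
  assumes "u \<in> artin_words n" "v \<in> artin_words n"
  shows "braid_class n u = braid_class n v \<longleftrightarrow> (u, v) \<in> braid_rel n"
  unfolding braid_class_def using eq_equiv_class_iff[OF equiv_braid_rel assms] .

lemma mem_braid_class_iff: "v \<in> braid_class n u \<longleftrightarrow> (u, v) \<in> braid_rel n"
  by (simp add: braid_class_def)

lemma braid_rel_context:
  assumes "(u, v) \<in> braid_rel n" "x \<in> artin_words n" "y \<in> artin_words n"
  shows "(x @ u @ y, x @ v @ y) \<in> braid_rel n"
  using assms
proof (induction rule: braid_rel.induct)
  case (refl u)
  then show ?case by (simp add: braid_rel.refl)
next
  case (sym u v)
  then show ?case by (simp add: braid_rel.sym)
next
  case (trans u v w)
  then show ?case using braid_rel.trans by simp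
next
  case (cancel u v i e)
  then show ?case using braid_rel.cancel[of "x @ u" n "v @ y" i e] by simp
next
  case (commute u v i j)
  then show ?case using braid_rel.commute[of "x @ u" n "v @ y" i j] by simp
next
  case (braid u v i j)
  then show ?case using braid_rel.braid[of "x @ u" n "v @ y" i j] by simp
qed

lemma braid_rel_append:
  assumes "(u, u') \<in> braid_rel n" "(v, v') \<in> braid_rel n"
  shows "(u @ v, u' @ v') \<in> braid_rel n"
proof -
  have "(u @ v, u' @ v) \<in> braid_rel n"
    using braid_rel_context[OF assms(1), of "[]" v] braid_rel_artin_words[OF assms(2)] by simp
  moreover have "(u' @ v, u' @ v') \<in> braid_rel n"
    using braid_rel_context[OF assms(2), of u' "[]"] braid_rel_artin_words[OF assms(1)] by simp
  ultimately show ?thesis by (rule braid_rel.trans)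
qed

definition formal_inverse :: "artin_word \<Rightarrow> artin_word" where
  "formal_inverse w = rev (map inv_letter w)"

lemma formal_inverse_artin_words [simp]:
  "formal_inverse w \<in> artin_words n \<longleftrightarrow> w \<in> artin_words n"
  by (simp add: formal_inverse_def)

lemma formal_inverse_left:
  "w \<in> artin_words n \<Longrightarrow> (formal_inverse w @ w, []) \<in> braid_rel n"
proof (induction w)
  case Nil
  then show ?case by (simp add: formal_inverse_def braid_rel.refl)
next
  case (Cons x w)
  obtain k e where x: "x = (k, e)" by force
  have "(formal_inverse w @ [(k, \<not> e), (k, \<not> \<not> e)] @ w, formal_inverse w @ w) \<in> braid_rel n"
    using Cons.prems x by (intro braid_rel.cancel) auto
  then show ?case
    using Cons x by (auto simp: formal_inverse_def intro: braid_rel.trans)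
qed

lemma carrier_braid_group:
  "carrier (braid_group n) = braid_class n ` artin_words n"
  by (auto simp: braid_group_def quotient_def braid_class_def)

lemma braid_carrierE:
  assumes "\<beta> \<in> carrier (braid_group n)"
  obtains w where "w \<in> artin_words n" "\<beta> = braid_class n w"
  using assms by (auto simp: carrier_braid_group)

lemma braid_class_carrier [simp]:
  "w \<in> artin_words n \<Longrightarrow> braid_class n w \<in> carrier (braid_group n)"
  by (simp add: carrier_braid_group)

lemma one_braid_group: "\<one>\<^bsub>braid_group n\<^esub> = braid_class n []"
  by (simp add: braid_group_def)

lemma mult_braid_class:
  assumes "u \<in> artin_words n" "v \<in> artin_words n"
  shows "braid_class n u \<otimes>\<^bsub>braid_group n\<^esub> braid_class n v = braid_class n (u @ v)"
proof -
  have "(\<Union>u'\<in>braid_class n u. \<Union>v'\<in>braid_class n v. braid_class n (u' @ v')) = braid_class n (u @ v)"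
  proof (rule UN_equiv_class2[OF equiv_braid_rel equiv_braid_rel, folded braid_class_def])
    show "congruent2 (braid_rel n) (braid_rel n) (\<lambda>u v. braid_class n (u @ v))"
      by (rule congruent2I')
        (simp add: braid_class_eq_iff braid_rel_artin_words braid_rel_append)
  qed (use assms in auto)
  then show ?thesis by (simp add: braid_group_def)
qed

lemma group_braid_group: "group (braid_group n)"
proof (rule groupI)
  fix x assume "x \<in> carrier (braid_group n)"
  then obtain w where w: "w \<in> artin_words n" "x = braid_class n w" by (rule braid_carrierE)
  show "\<exists>y\<in>carrier (braid_group n). y \<otimes>\<^bsub>braid_group n\<^esub> x = \<one>\<^bsub>braid_group n\<^esub>"
    using w formal_inverse_left[OF w(1)]
    by (intro bexI[of _ "braid_class n (formal_inverse w)"])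
       (simp_all add: mult_braid_class one_braid_group braid_class_eq_iff)
next
  fix x y z
  assume "x \<in> carrier (braid_group n)" "y \<in> carrier (braid_group n)" "z \<in> carrier (braid_group n)"
  then show "x \<otimes>\<^bsub>braid_group n\<^esub> y \<otimes>\<^bsub>braid_group n\<^esub> z =
      x \<otimes>\<^bsub>braid_group n\<^esub> (y \<otimes>\<^bsub>braid_group n\<^esub> z)"
    by (elim braid_carrierE) (simp add: mult_braid_class)
qed (auto simp: mult_braid_class one_braid_group carrier_braid_group)

lemma inv_braid_class:
  assumes "w \<in> artin_words n"
  shows "inv\<^bsub>braid_group n\<^esub> braid_class n w = braid_class n (formal_inverse w)"
  using assms formal_inverse_left[OF assms]
  by (intro group.inv_equality[OF group_braid_group])
     (auto simp: mult_braid_class one_braid_group braid_class_eq_iff)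


section \<open>Permutation and linking numbers\<close>

lemma word_perm_simps [simp]:
  "word_perm [] = id"
  "word_perm ((k, e) # w) = transpose k (Suc k) \<circ> word_perm w"
  by (auto simp: word_perm_def)

lemma word_perm_append: "word_perm (u @ v) = word_perm u \<circ> word_perm v"
  by (induction u) auto

lemma bij_word_perm: "bij (word_perm w)"
  by (induction w) (auto simp: bij_comp bij_id[unfolded id_def])

lemma word_perm_outside:
  "w \<in> artin_words n \<Longrightarrow> k \<notin> {1..n} \<Longrightarrow> word_perm w k = k"
  by (induction w) (auto simp: transpose_def)

lemma doubleton_involution_iff:
  assumes "\<And>x. s (s x) = x"
  shows "{s a, s b} = {i, j} \<longleftrightarrow> {a, b} = {s i, s j}"
  using assms by (metis (no_types, opaque_lifting) doubleton_eq_iff)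

lemma word_linking_Nil [simp]: "word_linking i j [] = 0"
  by (simp add: word_linking_def)

lemma word_linking_Cons [simp]:
  "word_linking i j ((k, e) # w) =
     (if {k, Suc k} = {i, j} then (if e then 1 else -1) else 0) +
     word_linking (transpose k (Suc k) i) (transpose k (Suc k) j) w"
  unfolding word_linking_def
  by (simp add: sum.lessThan_Suc_shift Let_def split_beta doubleton_involution_iff
      del: sum.lessThan_Suc cong: if_cong)

lemma word_linking_append:
  "word_linking i j (u @ v) =
     word_linking i j u + word_linking (inv_into UNIV (word_perm u) i) (inv_into UNIV (word_perm u) j) v"
proof (induction u arbitrary: i j)
  case (Cons x u)
  obtain k e where x: "x = (k, e)" by force
  have "inv_into UNIV (word_perm ((k, e) # u)) = inv_into UNIV (word_perm u) \<circ> transpose k (Suc k)"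
    by (simp add: o_inv_distrib[OF _ bij_word_perm])
  then show ?case using Cons x by (simp del: word_perm_simps)
qed simp

lemma word_linking_commute: "word_linking i j w = word_linking j i w"
  by (simp add: word_linking_def insert_commute)

lemma word_linking_self: "word_linking i i w = 0"
  by (induction w arbitrary: i) auto

lemma word_linking_outside:
  "w \<in> artin_words n \<Longrightarrow> i \<notin> {1..n} \<Longrightarrow> word_linking i j w = 0"
proof (induction w arbitrary: i j)
  case (Cons x w)
  obtain k e where x: "x = (k, e)" by force
  then have "transpose k (Suc k) i = i" "{k, Suc k} \<noteq> {i, j}"
    using Cons.prems by (auto simp: transpose_def doubleton_eq_iff)
  then show ?case using Cons x by simp
qed simp

lemma doubleton_transpose_iff:
  "{a, b} = {transpose x y i, transpose x y j} \<longleftrightarrow> {transpose x y a, transpose x y b} = {i, j}"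
  by (rule doubleton_involution_iff[symmetric]) simp

lemma invariants_context:
  assumes "word_perm x = word_perm y" "\<And>i j. word_linking i j x = word_linking i j y"
  shows "word_perm (u @ x @ v) = word_perm (u @ y @ v) \<and>
    (\<forall>i j. word_linking i j (u @ x @ v) = word_linking i j (u @ y @ v))"
  by (simp only: word_perm_append word_linking_append assms simp_thms)

lemma braid_rel_invariants:
  assumes "(u, v) \<in> braid_rel n"
  shows "word_perm u = word_perm v \<and> (\<forall>i j. word_linking i j u = word_linking i j v)"
  using assms
proof (induction rule: braid_rel.induct)
  case (cancel u v i e)
  have "word_perm [(i, e), (i, \<not> e)] = word_perm []" by (auto simp: fun_eq_iff)
  moreover have "word_linking a b [(i, e), (i, \<not> e)] = word_linking a b []" for a b
    by (simp add: doubleton_transpose_iff insert_commute)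
  ultimately show ?case by (rule invariants_context[of _ "[]", unfolded append_Nil])
next
  case (commute u v i j)
  then have ij: "i \<noteq> j" "i \<noteq> Suc j" "j \<noteq> Suc i" by auto
  have "word_perm [(i, True), (j, True)] = word_perm [(j, True), (i, True)]"
    using ij by (auto simp: fun_eq_iff transpose_def)
  moreover have "word_linking a b [(i, True), (j, True)] = word_linking a b [(j, True), (i, True)]" for a b
    using ij by (simp add: doubleton_transpose_iff)
  ultimately show ?case by (rule invariants_context)
next
  case (braid u v i j)
  have *: "word_perm [(i, True), (Suc i, True), (i, True)] =
      word_perm [(Suc i, True), (i, True), (Suc i, True)]"
    "word_linking a b [(i, True), (Suc i, True), (i, True)] =
      word_linking a b [(Suc i, True), (i, True), (Suc i, True)]" for i a b
    by (auto simp: fun_eq_iff transpose_def)[1] (simp add: doubleton_transpose_iff)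
  from braid have "j = Suc i \<or> i = Suc j" by auto
  then show ?case
    using invariants_context[OF *(1)[of i] *(2)[of _ _ i]]
      invariants_context[OF *(1)[of j, symmetric] *(2)[of _ _ j, symmetric]] by blast
qed auto

lemma the_elem_image_class:
  assumes "w \<in> artin_words n" "\<And>v. (w, v) \<in> braid_rel n \<Longrightarrow> f v = f w"
  shows "the_elem (f ` braid_class n w) = f w"
proof -
  have "f ` braid_class n w = {f w}"
    using assms(2) braid_rel.refl[OF assms(1)] unfolding mem_braid_class_iff[symmetric] by blast
  then show ?thesis by simp
qed

lemma braid_perm_class: "w \<in> artin_words n \<Longrightarrow> braid_perm (braid_class n w) = word_perm w"
  unfolding braid_perm_def by (rule the_elem_image_class) (simp_all add: braid_rel_invariants)

lemma linking_class: "w \<in> artin_words n \<Longrightarrow> linking i j (braid_class n w) = word_linking i j w"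
  unfolding linking_def by (rule the_elem_image_class) (simp_all add: braid_rel_invariants)

lemma bij_braid_perm: "\<beta> \<in> carrier (braid_group n) \<Longrightarrow> bij (braid_perm \<beta>)"
  by (elim braid_carrierE) (simp add: braid_perm_class bij_word_perm)

lemma braid_perm_mult:
  assumes "\<beta> \<in> carrier (braid_group n)" "\<gamma> \<in> carrier (braid_group n)"
  shows "braid_perm (\<beta> \<otimes>\<^bsub>braid_group n\<^esub> \<gamma>) = braid_perm \<beta> \<circ> braid_perm \<gamma>"
  using assms by (elim braid_carrierE) (simp add: mult_braid_class braid_perm_class word_perm_append)

lemma linking_mult:
  assumes "\<beta> \<in> carrier (braid_group n)" "\<gamma> \<in> carrier (braid_group n)"
  shows "linking i j (\<beta> \<otimes>\<^bsub>braid_group n\<^esub> \<gamma>) =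
    linking i j \<beta> + linking (inv_into UNIV (braid_perm \<beta>) i) (inv_into UNIV (braid_perm \<beta>) j) \<gamma>"
  using assms
  by (elim braid_carrierE) (simp add: mult_braid_class braid_perm_class linking_class word_linking_append)

lemma braid_perm_inv:
  assumes "\<beta> \<in> carrier (braid_group n)"
  shows "braid_perm (inv\<^bsub>braid_group n\<^esub> \<beta>) = inv_into UNIV (braid_perm \<beta>)"
proof -
  interpret group "braid_group n" by (rule group_braid_group)
  have "braid_perm (inv\<^bsub>braid_group n\<^esub> \<beta>) \<circ> braid_perm \<beta> = id"
    using assms braid_perm_mult[of "inv\<^bsub>braid_group n\<^esub> \<beta>" n \<beta>]
    by (simp add: one_braid_group braid_perm_class)
  then show ?thesis using bij_braid_perm[OF assms]
    by (metis bij_is_surj comp_assoc comp_id id_comp surj_iff)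
qed

lemma linking_inv:
  assumes "\<beta> \<in> carrier (braid_group n)"
  shows "linking i j (inv\<^bsub>braid_group n\<^esub> \<beta>) = - linking (braid_perm \<beta> i) (braid_perm \<beta> j) \<beta>"
proof -
  interpret group "braid_group n" by (rule group_braid_group)
  show ?thesis
    using assms linking_mult[of "inv\<^bsub>braid_group n\<^esub> \<beta>" n \<beta> i j]
    by (simp add: one_braid_group linking_class braid_perm_inv inv_inv_eq bij_braid_perm)
qed

lemma concat_map_map_eq_iff:
  "concat (map (\<lambda>j. map (f j) (g j)) js) = concat (map (\<lambda>j. map (f' j) (g j)) js) \<longleftrightarrow>
     (\<forall>j\<in>set js. \<forall>i\<in>set (g j). f j i = f' j i)"
  by (induction js) auto

lemma template_eq_iff:
  assumes "\<beta> \<in> carrier (braid_group n)" "\<gamma> \<in> carrier (braid_group n)"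
  shows "template n \<beta> = template n \<gamma> \<longleftrightarrow>
    braid_perm \<beta> = braid_perm \<gamma> \<and> (\<forall>i j. linking i j \<beta> = linking i j \<gamma>)"
    (is "_ \<longleftrightarrow> _ \<and> ?L")
proof -
  obtain u v where uv: "u \<in> artin_words n" "\<beta> = braid_class n u"
      "v \<in> artin_words n" "\<gamma> = braid_class n v"
    using assms by (elim braid_carrierE)
  have "?L" if eq: "\<forall>j\<in>{2..n}. \<forall>i\<in>{1..<j}. linking i j \<beta> = linking i j \<gamma>"
  proof (intro allI)
    fix i j
    have *: "word_linking i j u = word_linking i j v" if "i < j" for i j
    proof (cases "1 \<le> i \<and> j \<le> n")
      case True
      then show ?thesis using eq that uv by (auto simp: linking_class)
    next
      case False
      then show ?thesis
        using uv word_linking_outside[of _ n i j] word_linking_outside[of _ n j i]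
        by (auto simp: word_linking_commute[of i j])
    qed
    show "linking i j \<beta> = linking i j \<gamma>"
      using *[of i j] *[of j i] uv
      by (cases i j rule: linorder_cases)
         (auto simp: linking_class word_linking_self word_linking_commute[of i j])
  qed
  then show ?thesis
    by (auto simp: template_def concat_map_map_eq_iff atLeastLessThanSuc_atLeastAtMost
             simp del: upt_Suc)
qed

lemma template_inv_eq_iff:
  assumes "\<beta> \<in> carrier (braid_group n)" "\<gamma> \<in> carrier (braid_group n)"
  shows "template n (inv\<^bsub>braid_group n\<^esub> \<beta>) = template n (inv\<^bsub>braid_group n\<^esub> \<gamma>) \<longleftrightarrow>
    template n \<beta> = template n \<gamma>"
proof -
  interpret group "braid_group n" by (rule group_braid_group)
  have "template n (inv\<^bsub>braid_group n\<^esub> \<beta>) = template n (inv\<^bsub>braid_group n\<^esub> \<gamma>)"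
    if "template n \<beta> = template n \<gamma>" "\<beta> \<in> carrier (braid_group n)" "\<gamma> \<in> carrier (braid_group n)" for \<beta> \<gamma>
    using that by (simp add: template_eq_iff braid_perm_inv linking_inv)
  from this[of \<beta> \<gamma>] this[of "inv\<^bsub>braid_group n\<^esub> \<beta>" "inv\<^bsub>braid_group n\<^esub> \<gamma>"] show ?thesis
    using assms by auto
qed

lemma template_conj_eq_iff:
  assumes "\<beta> \<in> carrier (braid_group n)" "\<gamma> \<in> carrier (braid_group n)"
    and "\<alpha> \<in> carrier (braid_group n)"
  shows "template n (\<alpha> \<otimes>\<^bsub>braid_group n\<^esub> \<beta> \<otimes>\<^bsub>braid_group n\<^esub> inv\<^bsub>braid_group n\<^esub> \<alpha>) =
      template n (\<alpha> \<otimes>\<^bsub>braid_group n\<^esub> \<gamma> \<otimes>\<^bsub>braid_group n\<^esub> inv\<^bsub>braid_group n\<^esub> \<alpha>) \<longleftrightarrow>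
    template n \<beta> = template n \<gamma>"
proof -
  interpret G: group "braid_group n" by (rule group_braid_group)
  let ?c = "\<lambda>\<alpha> \<beta>. \<alpha> \<otimes>\<^bsub>braid_group n\<^esub> \<beta> \<otimes>\<^bsub>braid_group n\<^esub> inv\<^bsub>braid_group n\<^esub> \<alpha>"
  have *: "template n (?c \<alpha> \<beta>) = template n (?c \<alpha> \<gamma>)"
    if "template n \<beta> = template n \<gamma>" "\<beta> \<in> carrier (braid_group n)" "\<gamma> \<in> carrier (braid_group n)"
      "\<alpha> \<in> carrier (braid_group n)" for \<alpha> \<beta> \<gamma>
    using that by (simp add: template_eq_iff braid_perm_mult linking_mult)
  have "?c (inv\<^bsub>braid_group n\<^esub> \<alpha>) (?c \<alpha> \<beta>) = \<beta>" if "\<beta> \<in> carrier (braid_group n)" for \<beta>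
    using that assms(3) by (simp add: G.m_assoc) (simp add: G.m_assoc[symmetric])
  then show ?thesis
    using assms *[of \<beta> \<gamma> \<alpha>] *[of "?c \<alpha> \<beta>" "?c \<alpha> \<gamma>" "inv\<^bsub>braid_group n\<^esub> \<alpha>"] by auto
qed


section \<open>Words over the two alphabets\<close>

lemma gen_braid_carrier: "g \<in> gens n S \<Longrightarrow> gen_braid n g \<in> carrier (braid_group n)"
  by (cases S) (force simp: map_artin_words_iff intro!: braid_class_carrier)+

lemma letter_braid_carrier:
  assumes "x \<in> gens n S \<times> UNIV"
  shows "letter_braid n x \<in> carrier (braid_group n)"
proof -
  interpret group "braid_group n" by (rule group_braid_group)
  show ?thesis using assms by (auto simp: letter_braid_def gen_braid_carrier)
qed

lemma letter_braid_inv_letter: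
  assumes "x \<in> gens n S \<times> UNIV"
  shows "letter_braid n (inv_letter x) = inv\<^bsub>braid_group n\<^esub> letter_braid n x"
proof -
  interpret group "braid_group n" by (rule group_braid_group)
  show ?thesis using assms by (auto simp: letter_braid_def gen_braid_carrier)
qed

lemma words_simps [simp]:
  "[] \<in> words n S"
  "x # w \<in> words n S \<longleftrightarrow> x \<in> gens n S \<times> UNIV \<and> w \<in> words n S"
  by (auto simp: words_def)

lemma word_braid_simps [simp]:
  "word_braid n [] = \<one>\<^bsub>braid_group n\<^esub>"
  "word_braid n (x # w) = letter_braid n x \<otimes>\<^bsub>braid_group n\<^esub> word_braid n w"
  by (auto simp: word_braid_def)

lemma word_braid_carrier: "w \<in> words n S \<Longrightarrow> word_braid n w \<in> carrier (braid_group n)"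
proof (induction w)
  interpret group "braid_group n" by (rule group_braid_group)
  {
    case Nil
    then show ?case by simp
  next
    case (Cons x w)
    then show ?case using letter_braid_carrier[of x n S] by (simp del: mem_Times_iff)
  }
qed

lemma word_braid_append:
  assumes "u \<in> words n S" "v \<in> words n S"
  shows "word_braid n (u @ v) = word_braid n u \<otimes>\<^bsub>braid_group n\<^esub> word_braid n v"
proof -
  interpret group "braid_group n" by (rule group_braid_group)
  show ?thesis
    using assms(1)
    by (induction u)
       (simp_all add: word_braid_carrier[OF assms(2)] word_braid_carrier[of _ n S]
          letter_braid_carrier[of _ n S] m_assoc del: mem_Times_iff)
qed

lemma inv_word_words: "w \<in> words n S \<Longrightarrow> inv_word w \<in> words n S"
  by (auto simp: inv_word_def words_def in_lists_conv_set inv_letter_def)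

lemma inv_word_inv_word [simp]: "inv_word (inv_word w) = w"
  by (simp add: inv_word_def rev_map comp_def)

lemma word_braid_inv_word:
  "w \<in> words n S \<Longrightarrow> word_braid n (inv_word w) = inv\<^bsub>braid_group n\<^esub> word_braid n w"
proof (induction w)
  interpret group "braid_group n" by (rule group_braid_group)
  {
    case Nil
    then show ?case by (simp add: inv_word_def)
  next
    case (Cons x w)
    have x: "x \<in> gens n S \<times> UNIV" and w: "w \<in> words n S" using Cons.prems by (auto simp del: mem_Times_iff)
    have "[inv_letter x] \<in> words n S" using x by (auto simp: inv_letter_def)
    then have "word_braid n (inv_word (x # w)) =
        word_braid n (inv_word w) \<otimes>\<^bsub>braid_group n\<^esub> word_braid n [inv_letter x]"
      using word_braid_append[of "inv_word w" n S "[inv_letter x]"] inv_word_words[OF w]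
      by (simp add: inv_word_def)
    then show ?case
      using Cons.IH[OF w] letter_braid_carrier[OF x] word_braid_carrier[OF w]
      by (simp add: letter_braid_inv_letter[OF x] inv_mult_group)
  }
qed

lemma word_braid_artin_word:
  assumes g: "\<And>k. k \<in> {1..<n} \<Longrightarrow> gen_braid n (g k) = braid_class n [(k, True)]"
    and w: "w \<in> artin_words n"
  shows "word_braid n (map (apfst g) w) = braid_class n w"
  using w
proof (induction w)
  case (Cons x w)
  obtain k e where x: "x = (k, e)" by force
  have "letter_braid n (g k, e) = braid_class n [(k, e)]"
    using Cons.prems x by (simp add: letter_braid_def g inv_braid_class formal_inverse_def)
  then show ?case using Cons x by (simp add: mult_braid_class)
qed (simp add: one_braid_group)

lemma words_Artin: "words n Artin = map (apfst Sig) ` artin_words n"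
proof -
  have "gens n Artin \<times> UNIV = apfst Sig ` ({1..<n} \<times> (UNIV :: bool set))"
    by (force simp: image_iff)
  then show ?thesis unfolding words_def artin_words_def by (metis lists_image)
qed

lemma word_braid_map_Sig: "w \<in> artin_words n \<Longrightarrow> word_braid n (map (apfst Sig) w) = braid_class n w"
  by (rule word_braid_artin_word) auto

lemma ex_word_braid:
  assumes "\<beta> \<in> carrier (braid_group n)"
  obtains w where "w \<in> words n S" "word_braid n w = \<beta>"
proof -
  obtain v where v: "v \<in> artin_words n" "\<beta> = braid_class n v"
    using assms by (rule braid_carrierE)
  show thesis
  proof (cases S)
    case Artin
    then show thesis using that[of "map (apfst Sig) v"] v by (auto simp: words_Artin word_braid_map_Sig)
  next
    case Dual
    have "map (apfst (\<lambda>k. Band k (Suc k))) v \<in> words n Dual"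
      using v by (force simp: words_def artin_words_def in_lists_conv_set)
    then show thesis
      using that Dual v word_braid_artin_word[of n "\<lambda>k. Band k (Suc k)" v] by simp
  qed
qed

lemma braid_length_word:
  assumes "\<beta> \<in> carrier (braid_group n)"
  obtains w where "w \<in> words n S" "word_braid n w = \<beta>" "length w = braid_length n S \<beta>"
proof -
  have "\<exists>r. \<exists>w\<in>words n S. word_braid n w = \<beta> \<and> length w = r"
    using ex_word_braid[OF assms, of S] by blast
  from LeastI_ex[OF this] show thesis
    using that by (auto simp: braid_length_def)
qed

lemma finite_braids_of_length: "finite (braids_of_length n S l)"
proof -
  have "gens n Artin \<subseteq> Sig ` {..n}" "gens n Dual \<subseteq> (\<lambda>(p, q). Band p q) ` ({..n} \<times> {..n})"
    by auto
  then have "finite (gens n Artin)" "finite (gens n Dual)"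
    by (auto intro: finite_subset simp del: gens.simps)
  then have "finite (gens n S)" by (cases S) (simp_all only:)
  then have "finite (gens n S \<times> (UNIV :: bool set))" by simp
  then have "finite {w. set w \<subseteq> gens n S \<times> (UNIV :: bool set) \<and> length w = l}"
    by (rule finite_lists_length_eq)
  moreover have "braids_of_length n S l \<subseteq> word_braid n ` {w. set w \<subseteq> gens n S \<times> UNIV \<and> length w = l}"
  proof
    fix \<beta> assume "\<beta> \<in> braids_of_length n S l"
    then have \<beta>: "\<beta> \<in> carrier (braid_group n)" "braid_length n S \<beta> = l"
      by (simp_all add: braids_of_length_def)
    obtain w where "w \<in> words n S" "word_braid n w = \<beta>" "length w = braid_length n S \<beta>"
      using braid_length_word[OF \<beta>(1)] .
    then show "\<beta> \<in> word_braid n ` {w. set w \<subseteq> gens n S \<times> UNIV \<and> length w = l}"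
      using \<beta>(2) by (intro image_eqI[of _ _ w]) (simp_all add: words_def lists_eq_set)
  qed
  ultimately show ?thesis by (meson finite_imageI finite_subset)
qed


section \<open>Symmetries of the braid group\<close>

lemma involution_image:
  assumes "\<And>x. x \<in> A \<Longrightarrow> f x \<in> A" "\<And>x. x \<in> A \<Longrightarrow> f (f x) = x"
  shows "f ` A = A"
  using assms by (metis image_eqI image_subsetI subsetI subset_antisym)

locale braid_symmetry =
  fixes n :: nat and S :: alphabet and \<mu> :: "letter list \<Rightarrow> letter list" and M :: "braid \<Rightarrow> braid"
  assumes image_words: "\<mu> ` words n S = words n S"
    and length_word: "w \<in> words n S \<Longrightarrow> length (\<mu> w) = length w"
    and word_braid: "w \<in> words n S \<Longrightarrow> word_braid n (\<mu> w) = M (word_braid n w)"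
    and inj: "inj_on M (carrier (braid_group n))"
    and template_iff: "\<lbrakk>\<beta> \<in> carrier (braid_group n); \<gamma> \<in> carrier (braid_group n)\<rbrakk> \<Longrightarrow>
      template n (M \<beta>) = template n (M \<gamma>) \<longleftrightarrow> template n \<beta> = template n \<gamma>"
begin

lemma image_carrier: "M ` carrier (braid_group n) = carrier (braid_group n)"
proof -
  have "carrier (braid_group n) = word_braid n ` words n S"
    by (auto simp: word_braid_carrier elim: ex_word_braid[of _ n S])
  then show ?thesis
    by (metis (no_types, lifting) image_words word_braid image_cong image_image)
qed

lemma M_carrier: "\<beta> \<in> carrier (braid_group n) \<Longrightarrow> M \<beta> \<in> carrier (braid_group n)"
  using image_carrier by blast

lemma braid_length_M:
  assumes "\<beta> \<in> carrier (braid_group n)"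
  shows "braid_length n S (M \<beta>) = braid_length n S \<beta>"
proof -
  have "(\<exists>w\<in>words n S. word_braid n w = M \<beta> \<and> length w = r) \<longleftrightarrow>
      (\<exists>w\<in>words n S. word_braid n w = \<beta> \<and> length w = r)" (is "?L \<longleftrightarrow> ?R") for r
  proof
    assume ?L
    then obtain v where v: "v \<in> words n S" "word_braid n (\<mu> v) = M \<beta>" "length (\<mu> v) = r"
      using image_words by (metis imageE)
    then have "word_braid n v = \<beta>"
      using assms inj word_braid word_braid_carrier by (metis inj_onD)
    then show ?R using v length_word by auto
  next
    assume ?R
    then show ?L using word_braid length_word image_words by (metis imageI)
  qed
  then show ?thesis by (simp add: braid_length_def)
qed

lemma induced_template:
  assumes "\<beta> \<in> carrier (braid_group n)"
  shows "induced n S \<mu> (template n \<beta>) = template n (M \<beta>)"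
proof -
  obtain w where w: "w \<in> words n S" "word_braid n w = \<beta>"
    using ex_word_braid[OF assms] .
  have "(THE t'. \<exists>w\<in>words n S. template n (word_braid n w) = template n \<beta> \<and>
      template n (word_braid n (\<mu> w)) = t') = template n (M \<beta>)"
  proof (rule the_equality)
    show "\<exists>w\<in>words n S. template n (word_braid n w) = template n \<beta> \<and>
        template n (word_braid n (\<mu> w)) = template n (M \<beta>)"
      using w word_braid by auto
  next
    fix t' assume "\<exists>w\<in>words n S. template n (word_braid n w) = template n \<beta> \<and>
        template n (word_braid n (\<mu> w)) = t'"
    then show "t' = template n (M \<beta>)"
      using assms word_braid word_braid_carrier template_iff by metis
  qed
  then show ?thesis using assms by (simp add: induced_def templates_def)
qed

lemma induced_Bij: "induced n S \<mu> \<in> Bij (templates n)"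
proof -
  have "inj_on (induced n S \<mu>) (templates n)"
    by (auto simp: inj_on_def templates_def induced_template template_iff)
  moreover have "induced n S \<mu> ` templates n = template n ` M ` carrier (braid_group n)"
    by (simp add: templates_def image_image induced_template)
  ultimately show ?thesis
    by (simp add: Bij_def bij_betw_def image_carrier induced_def templates_def)
qed

lemma card_braids_of_induced_template:
  assumes "t \<in> templates n"
  shows "card (braids_of_template n S l (induced n S \<mu> t)) = card (braids_of_template n S l t)"
proof -
  obtain \<gamma> where \<gamma>: "\<gamma> \<in> carrier (braid_group n)" "t = template n \<gamma>"
    using assms by (auto simp: templates_def)
  have "M ` braids_of_template n S l t = braids_of_template n S l (induced n S \<mu> t)"
  proof
    show "M ` braids_of_template n S l t \<subseteq> braids_of_template n S l (induced n S \<mu> t)"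
      using \<gamma> by (auto simp: braids_of_template_def braids_of_length_def induced_template
          M_carrier braid_length_M template_iff)
    show "braids_of_template n S l (induced n S \<mu> t) \<subseteq> M ` braids_of_template n S l t"
    proof
      fix \<alpha> assume \<alpha>: "\<alpha> \<in> braids_of_template n S l (induced n S \<mu> t)"
      then have "\<alpha> \<in> M ` carrier (braid_group n)"
        by (simp add: braids_of_template_def braids_of_length_def image_carrier)
      then obtain \<beta> where "\<beta> \<in> carrier (braid_group n)" "\<alpha> = M \<beta>" by blast
      then show "\<alpha> \<in> M ` braids_of_template n S l t"
        using \<alpha> \<gamma> by (auto simp: braids_of_template_def braids_of_length_def induced_template
            braid_length_M template_iff)
    qed
  qed
  moreover have "inj_on M (braids_of_template n S l t)"
    using inj by (rule inj_on_subset) (auto simp: braids_of_template_def braids_of_length_def)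
  ultimately show ?thesis by (metis card_image)
qed

end

lemma braid_symmetry_inv: "braid_symmetry n S inv_word (\<lambda>\<beta>. inv\<^bsub>braid_group n\<^esub> \<beta>)"
proof
  interpret group "braid_group n" by (rule group_braid_group)
  show "inv_word ` words n S = words n S"
    by (rule involution_image) (simp_all add: inv_word_words)
  show "inj_on (\<lambda>\<beta>. inv\<^bsub>braid_group n\<^esub> \<beta>) (carrier (braid_group n))"
    by (rule inj_onI) (metis inv_inv)
  show "word_braid n (inv_word w) = inv\<^bsub>braid_group n\<^esub> word_braid n w"
    if "w \<in> words n S" for w using that by (rule word_braid_inv_word)
qed (simp_all add: template_inv_eq_iff, simp add: inv_word_def)


subsection \<open>Involutions of Artin words\<close>

definition map_braid :: "nat \<Rightarrow> (artin_word \<Rightarrow> artin_word) \<Rightarrow> braid \<Rightarrow> braid" where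
  "map_braid n f \<beta> = (\<Union>w\<in>\<beta>. braid_class n (f w))"

lemma map_braid_class:
  assumes f: "\<And>u v. (u, v) \<in> braid_rel n \<Longrightarrow> (f u, f v) \<in> braid_rel n"
    and "w \<in> artin_words n"
  shows "map_braid n f (braid_class n w) = braid_class n (f w)"
  unfolding map_braid_def
proof (rule UN_equiv_class[OF equiv_braid_rel, folded braid_class_def])
  show "(\<lambda>w. braid_class n (f w)) respects braid_rel n"
  proof (rule congruentI)
    fix u v assume "(u, v) \<in> braid_rel n"
    then have "(f u, f v) \<in> braid_rel n" by (rule f)
    then show "braid_class n (f u) = braid_class n (f v)"
      using braid_rel_artin_words by (simp add: braid_class_eq_iff)
  qed
qed fact

lemma braid_symmetry_Artin:
  assumes f: "\<And>u v. (u, v) \<in> braid_rel n \<Longrightarrow> (f u, f v) \<in> braid_rel n"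
    and invol: "\<And>w. w \<in> artin_words n \<Longrightarrow> f (f w) = w"
    and length_f: "\<And>w. length (f w) = length w"
    and \<mu>: "\<And>w. \<mu> (map (apfst Sig) w) = map (apfst Sig) (f w)"
    and template: "\<And>u v. \<lbrakk>u \<in> artin_words n; v \<in> artin_words n;
      template n (braid_class n u) = template n (braid_class n v)\<rbrakk> \<Longrightarrow>
      template n (braid_class n (f u)) = template n (braid_class n (f v))"
  shows "braid_symmetry n Artin \<mu> (map_braid n f)"
proof
  have closed: "f w \<in> artin_words n" if "w \<in> artin_words n" for w
    using that f[of w w] braid_rel.refl braid_rel_artin_words by blast
  have M: "map_braid n f (braid_class n w) = braid_class n (f w)" if "w \<in> artin_words n" for w
    using f that by (rule map_braid_class)
  have "f ` artin_words n = artin_words n"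
    using closed invol by (rule involution_image)
  then show "\<mu> ` words n Artin = words n Artin"
    by (metis (no_types, lifting) \<mu> image_cong image_image words_Artin)
  show "length (\<mu> w) = length w" if "w \<in> words n Artin" for w
    using that by (auto simp: words_Artin \<mu> length_f)
  show "word_braid n (\<mu> w) = map_braid n f (word_braid n w)" if "w \<in> words n Artin" for w
    using that by (auto simp: words_Artin \<mu> word_braid_map_Sig closed M)
  have "map_braid n f (map_braid n f \<beta>) = \<beta>" if "\<beta> \<in> carrier (braid_group n)" for \<beta>
    using that by (auto simp: carrier_braid_group M closed invol)
  then show "inj_on (map_braid n f) (carrier (braid_group n))"
    by (metis inj_on_inverseI)
  show "template n (map_braid n f \<beta>) = template n (map_braid n f \<gamma>) \<longleftrightarrow> template n \<beta> = template n \<gamma>"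
    if \<beta>: "\<beta> \<in> carrier (braid_group n)" and \<gamma>: "\<gamma> \<in> carrier (braid_group n)" for \<beta> \<gamma>
  proof -
    obtain u where "u \<in> artin_words n" "\<beta> = braid_class n u"
      using \<beta> by (rule braid_carrierE)
    moreover obtain v where "v \<in> artin_words n" "\<gamma> = braid_class n v"
      using \<gamma> by (rule braid_carrierE)
    ultimately show ?thesis
      using template[of u v] template[of "f u" "f v"] by (auto simp: M closed invol)
  qed
qed

lemma template_class_eq_iff:
  assumes "u \<in> artin_words n" "v \<in> artin_words n"
  shows "template n (braid_class n u) = template n (braid_class n v) \<longleftrightarrow>
    word_perm u = word_perm v \<and> (\<forall>i j. word_linking i j u = word_linking i j v)"
  using assms by (simp add: template_eq_iff braid_perm_class linking_class)

lemma rev_braid_rel: "(u, v) \<in> braid_rel n \<Longrightarrow> (rev u, rev v) \<in> braid_rel n"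
proof (induction rule: braid_rel.induct)
  case (refl u)
  then show ?case by (simp add: braid_rel.refl)
next
  case (sym u v)
  then show ?case by (simp add: braid_rel.sym)
next
  case (trans u v w)
  show ?case by (rule braid_rel.trans) fact+
next
  case (cancel u v i e)
  then show ?case using braid_rel.cancel[of "rev v" n "rev u" i "\<not> e"] by simp
next
  case (commute u v i j)
  then show ?case using braid_rel.commute[of "rev v" n "rev u" j i] by simp
next
  case (braid u v i j)
  then show ?case using braid_rel.braid[of "rev v" n "rev u" i j] by simp
qed

text \<open>
  Letterwise inversion is the formal inverse of the reversed word, and both of these operations
  respect the braid relations.
\<close>

lemma map_inv_letter_braid_rel:
  assumes "(u, v) \<in> braid_rel n"
  shows "(map inv_letter u, map inv_letter v) \<in> braid_rel n"
proof -
  have rel: "(rev u, rev v) \<in> braid_rel n" by (rule rev_braid_rel[OF assms])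
  then have words: "rev u \<in> artin_words n" "rev v \<in> artin_words n"
    using braid_rel_artin_words by blast+
  then have "braid_class n (formal_inverse (rev u)) = braid_class n (formal_inverse (rev v))"
    using rel by (metis braid_class_eq_iff inv_braid_class)
  then show ?thesis using words by (simp add: braid_class_eq_iff formal_inverse_def rev_map)
qed

lemma word_perm_map_inv_letter: "word_perm (map inv_letter w) = word_perm w"
  by (induction w) auto

lemma word_linking_map_inv_letter: "word_linking i j (map inv_letter w) = - word_linking i j w"
  by (induction w arbitrary: i j) auto

lemma braid_symmetry_theta: "braid_symmetry n Artin theta_word (map_braid n (map inv_letter))"
  by (rule braid_symmetry_Artin)
     (auto simp: theta_word_def map_inv_letter_braid_rel template_class_eq_iff comp_def
        inv_letter_apfst word_perm_map_inv_letter word_linking_map_inv_letter)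

definition flip_word :: "nat \<Rightarrow> artin_word \<Rightarrow> artin_word" where
  "flip_word n = map (apfst (\<lambda>k. n - k))"

text \<open>Fixing every \<open>k\<close> outside \<open>{1..n}\<close> makes this an involution of all of \<open>nat\<close>.\<close>

definition flip_strand :: "nat \<Rightarrow> nat \<Rightarrow> nat" where
  "flip_strand n k = (if k \<in> {1..n} then Suc n - k else k)"

lemma flip_strand_invol [simp]: "flip_strand n (flip_strand n k) = k"
  by (auto simp: flip_strand_def)

lemma flip_word_artin_words [simp]: "w \<in> artin_words n \<Longrightarrow> flip_word n w \<in> artin_words n"
  by (induction w) (auto simp: flip_word_def)

lemma flip_word_braid_rel: "(u, v) \<in> braid_rel n \<Longrightarrow> (flip_word n u, flip_word n v) \<in> braid_rel n"
proof (induction rule: braid_rel.induct)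
  case (refl u)
  then show ?case by (simp add: braid_rel.refl)
next
  case (sym u v)
  then show ?case by (simp add: braid_rel.sym)
next
  case (trans u v w)
  show ?case by (rule braid_rel.trans) fact+
next
  case (cancel u v i e)
  then show ?case
    using braid_rel.cancel[of "flip_word n u" n "flip_word n v" "n - i" e] flip_word_artin_words
    by (auto simp: flip_word_def)
next
  case (commute u v i j)
  then have "n - i \<in> {1..<n}" "n - j \<in> {1..<n}" "\<bar>int (n - i) - int (n - j)\<bar> \<ge> 2" by auto
  from braid_rel.commute[OF flip_word_artin_words[OF commute(1)] flip_word_artin_words[OF commute(2)] this]
  show ?case by (simp add: flip_word_def)
next
  case (braid u v i j)
  then have "n - i \<in> {1..<n}" "n - j \<in> {1..<n}" "\<bar>int (n - i) - int (n - j)\<bar> = 1" by auto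
  from braid_rel.braid[OF flip_word_artin_words[OF braid(1)] flip_word_artin_words[OF braid(2)] this]
  show ?case by (simp add: flip_word_def)
qed

lemma transpose_flip_strand:
  assumes "1 \<le> k" "k < n"
  shows "transpose (n - k) (Suc (n - k)) x = flip_strand n (transpose k (Suc k) (flip_strand n x))"
proof -
  have "n - k = flip_strand n (Suc k)" "Suc (n - k) = flip_strand n k"
    using assms by (auto simp: flip_strand_def)
  then show ?thesis
    unfolding transpose_def by (metis flip_strand_invol)
qed

lemma word_perm_flip_word:
  "w \<in> artin_words n \<Longrightarrow> word_perm (flip_word n w) x = flip_strand n (word_perm w (flip_strand n x))"
  by (induction w) (auto simp: flip_word_def transpose_flip_strand)

lemma word_linking_flip_word:
  "w \<in> artin_words n \<Longrightarrow>
    word_linking i j (flip_word n w) = word_linking (flip_strand n i) (flip_strand n j) w"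
proof (induction w arbitrary: i j)
  case (Cons x w)
  obtain k e where x: "x = (k, e)" by force
  have k: "1 \<le> k" "k < n" using Cons.prems x by auto
  then have "n - k = flip_strand n (Suc k)" "Suc (n - k) = flip_strand n k"
    by (auto simp: flip_strand_def)
  then have "{n - k, Suc (n - k)} = {i, j} \<longleftrightarrow> {k, Suc k} = {flip_strand n i, flip_strand n j}"
    using doubleton_involution_iff[of "flip_strand n" k "Suc k" i j] by (simp add: insert_commute)
  then show ?case
    using Cons x k by (simp add: flip_word_def transpose_flip_strand)
qed (simp add: flip_word_def)

lemma braid_symmetry_Phi: "braid_symmetry n Artin (Phi_word n) (map_braid n (flip_word n))"
proof (rule braid_symmetry_Artin)
  show "flip_word n (flip_word n w) = w" if "w \<in> artin_words n" for w
    using that by (induction w) (auto simp: flip_word_def)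
  show "template n (braid_class n (flip_word n u)) = template n (braid_class n (flip_word n v))"
    if "u \<in> artin_words n" "v \<in> artin_words n"
      "template n (braid_class n u) = template n (braid_class n v)" for u v
    using that by (simp add: template_class_eq_iff fun_eq_iff word_perm_flip_word word_linking_flip_word)
qed (auto simp: flip_word_braid_rel, auto simp: flip_word_def Phi_word_def)


subsection \<open>Rotation of dual words\<close>

definition ascending :: "nat \<Rightarrow> nat \<Rightarrow> nat \<Rightarrow> braid" where
  "ascending n p q = braid_class n (map (\<lambda>k. (k, True)) [p..<q])"

lemma ascending_carrier [simp]:
  "1 \<le> p \<Longrightarrow> q \<le> n \<Longrightarrow> ascending n p q \<in> carrier (braid_group n)"
  unfolding ascending_def by (rule braid_class_carrier) (auto simp: map_artin_words_iff)

lemma ascending_mult: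
  assumes "1 \<le> p" "p \<le> q" "q \<le> r" "r \<le> n"
  shows "ascending n p q \<otimes>\<^bsub>braid_group n\<^esub> ascending n q r = ascending n p r"
proof -
  have "[p..<r] = [p..<q] @ [q..<r]"
    using assms by (metis le_add_diff_inverse upt_add_eq_append)
  moreover have "set [p..<q] \<subseteq> {1..<n}" "set [q..<r] \<subseteq> {1..<n}" using assms by auto
  ultimately show ?thesis
    by (simp add: ascending_def mult_braid_class map_artin_words_iff del: set_upt)
qed

abbreviation artin_gen :: "nat \<Rightarrow> nat \<Rightarrow> braid" where
  "artin_gen n k \<equiv> ascending n k (Suc k)"

lemma artin_gen_commute:
  assumes "i \<in> {1..<n}" "j \<in> {1..<n}" "i + 2 \<le> j \<or> j + 2 \<le> i"
  shows "artin_gen n i \<otimes>\<^bsub>braid_group n\<^esub> artin_gen n j =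
    artin_gen n j \<otimes>\<^bsub>braid_group n\<^esub> artin_gen n i"
  using assms braid_rel.commute[of "[]" n "[]" i j]
  by (auto simp: ascending_def mult_braid_class braid_class_eq_iff)

lemma artin_gen_braid:
  assumes "1 \<le> i" "Suc i < n"
  shows "artin_gen n i \<otimes>\<^bsub>braid_group n\<^esub> (artin_gen n (Suc i) \<otimes>\<^bsub>braid_group n\<^esub> artin_gen n i) =
    artin_gen n (Suc i) \<otimes>\<^bsub>braid_group n\<^esub> (artin_gen n i \<otimes>\<^bsub>braid_group n\<^esub> artin_gen n (Suc i))"
  using assms braid_rel.braid[of "[]" n "[]" i "Suc i"]
  by (auto simp: ascending_def mult_braid_class braid_class_eq_iff)

lemma (in group) shift_mult:
  assumes "d \<in> carrier G" "a \<in> carrier G" "b \<in> carrier G" "a' \<in> carrier G" "b' \<in> carrier G"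
    and "d \<otimes> a = a' \<otimes> d" "d \<otimes> b = b' \<otimes> d"
  shows "d \<otimes> (a \<otimes> b) = a' \<otimes> b' \<otimes> d"
  using assms by (metis m_assoc)

lemma (in group) commute_inv:
  assumes "c \<in> carrier G" "a \<in> carrier G" "c \<otimes> a = a \<otimes> c"
  shows "c \<otimes> inv a = inv a \<otimes> c"
proof -
  have "a \<otimes> (c \<otimes> inv a) = (c \<otimes> a) \<otimes> inv a"
    using assms by (simp add: m_assoc)
  also have "\<dots> = c" using assms(1,2) by (simp add: m_assoc)
  finally show ?thesis using assms(1,2) by (simp add: inv_solve_left)
qed

lemma commute_ascending:
  assumes "X \<in> carrier (braid_group n)" "1 \<le> p" "p \<le> q" "q \<le> n"
    and "\<And>j. j \<in> {p..<q} \<Longrightarrow>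
      X \<otimes>\<^bsub>braid_group n\<^esub> artin_gen n j = artin_gen n j \<otimes>\<^bsub>braid_group n\<^esub> X"
  shows "X \<otimes>\<^bsub>braid_group n\<^esub> ascending n p q = ascending n p q \<otimes>\<^bsub>braid_group n\<^esub> X"
  using assms(3-5)
proof (induction q rule: dec_induct)
  interpret group "braid_group n" by (rule group_braid_group)
  {
    case base
    have "ascending n p p = \<one>\<^bsub>braid_group n\<^esub>" by (simp add: ascending_def one_braid_group)
    then show ?case using assms(1) by simp
  next
    case (step m)
    then show ?case
      using assms(1,2) shift_mult[of X "ascending n p m" "artin_gen n m" "ascending n p m" "artin_gen n m"]
      by (simp add: ascending_mult)
  }
qed

lemma ascending_commute:
  assumes "1 \<le> p" "p \<le> q" "q < r" "r \<le> s" "s \<le> n"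
  shows "ascending n p q \<otimes>\<^bsub>braid_group n\<^esub> ascending n r s =
    ascending n r s \<otimes>\<^bsub>braid_group n\<^esub> ascending n p q"
proof (rule commute_ascending)
  fix j assume j: "j \<in> {r..<s}"
  show "ascending n p q \<otimes>\<^bsub>braid_group n\<^esub> artin_gen n j = artin_gen n j \<otimes>\<^bsub>braid_group n\<^esub> ascending n p q"
  proof (rule commute_ascending[symmetric])
    fix i assume "i \<in> {p..<q}"
    then show "artin_gen n j \<otimes>\<^bsub>braid_group n\<^esub> artin_gen n i =
        artin_gen n i \<otimes>\<^bsub>braid_group n\<^esub> artin_gen n j"
      using assms j by (intro artin_gen_commute) auto
  qed (use assms j in auto)
qed (use assms in auto)

lemma ascending_shift_gen:
  assumes "1 \<le> i" "Suc i < n"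
  shows "ascending n (Suc 0) n \<otimes>\<^bsub>braid_group n\<^esub> artin_gen n i =
    artin_gen n (Suc i) \<otimes>\<^bsub>braid_group n\<^esub> ascending n (Suc 0) n"
proof -
  interpret group "braid_group n" by (rule group_braid_group)
  let ?A = "ascending n (Suc 0) i" and ?s = "artin_gen n i" and ?t = "artin_gen n (Suc i)"
    and ?B = "ascending n (Suc (Suc i)) n"
  have carr: "?A \<in> carrier (braid_group n)" "?s \<in> carrier (braid_group n)"
      "?t \<in> carrier (braid_group n)" "?B \<in> carrier (braid_group n)"
    using assms by auto
  have delta: "ascending n (Suc 0) n = ?A \<otimes>\<^bsub>braid_group n\<^esub> (?s \<otimes>\<^bsub>braid_group n\<^esub> (?t \<otimes>\<^bsub>braid_group n\<^esub> ?B))"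
    using assms by (simp add: ascending_mult)
  have sB: "?B \<otimes>\<^bsub>braid_group n\<^esub> ?s = ?s \<otimes>\<^bsub>braid_group n\<^esub> ?B"
    using assms ascending_commute[of i "Suc i" "Suc (Suc i)" n n] by simp
  have tA: "?A \<otimes>\<^bsub>braid_group n\<^esub> ?t = ?t \<otimes>\<^bsub>braid_group n\<^esub> ?A"
    using assms ascending_commute[of "Suc 0" i "Suc i" "Suc (Suc i)" n] by simp
  have "ascending n (Suc 0) n \<otimes>\<^bsub>braid_group n\<^esub> ?s =
      ?A \<otimes>\<^bsub>braid_group n\<^esub> ((?s \<otimes>\<^bsub>braid_group n\<^esub> (?t \<otimes>\<^bsub>braid_group n\<^esub> ?s)) \<otimes>\<^bsub>braid_group n\<^esub> ?B)"
    using carr by (simp add: delta sB m_assoc)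
  also have "\<dots> = ?A \<otimes>\<^bsub>braid_group n\<^esub> ?t \<otimes>\<^bsub>braid_group n\<^esub> (?s \<otimes>\<^bsub>braid_group n\<^esub> (?t \<otimes>\<^bsub>braid_group n\<^esub> ?B))"
    using carr by (simp add: artin_gen_braid[OF assms] m_assoc)
  also have "\<dots> = ?t \<otimes>\<^bsub>braid_group n\<^esub> ascending n (Suc 0) n"
    using carr by (simp add: delta tA m_assoc)
  finally show ?thesis .
qed

lemma ascending_shift:
  assumes "1 \<le> p" "p \<le> q" "q < n"
  shows "ascending n (Suc 0) n \<otimes>\<^bsub>braid_group n\<^esub> ascending n p q =
    ascending n (Suc p) (Suc q) \<otimes>\<^bsub>braid_group n\<^esub> ascending n (Suc 0) n"
  using assms(2,3)
proof (induction q rule: dec_induct)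
  interpret group "braid_group n" by (rule group_braid_group)
  let ?d = "ascending n (Suc 0) n"
  {
    case base
    have "ascending n k k = \<one>\<^bsub>braid_group n\<^esub>" for k by (simp add: ascending_def one_braid_group)
    then show ?case by simp
  next
    case (step m)
    then show ?case
      using assms(1) ascending_shift_gen[of m n] ascending_mult[of p m "Suc m" n]
        ascending_mult[of "Suc p" "Suc m" "Suc (Suc m)" n]
        shift_mult[of ?d "ascending n p m" "artin_gen n m" "ascending n (Suc p) (Suc m)" "artin_gen n (Suc m)"]
      by simp
  }
qed

lemma gen_braid_Band:
  assumes "1 \<le> p" "p < q" "q \<le> n"
  shows "gen_braid n (Band p q) =
    ascending n p q \<otimes>\<^bsub>braid_group n\<^esub> inv\<^bsub>braid_group n\<^esub> ascending n p (q - 1)"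
proof -
  obtain r where r: "q = Suc r" using assms by (cases q) auto
  have "set [p..<q] \<subseteq> {1..<n}" "set [p..<q - 1] \<subseteq> {1..<n}" using assms by auto
  then show ?thesis
    using assms r
    by (simp add: ascending_def inv_braid_class mult_braid_class map_artin_words_iff formal_inverse_def
        rev_map comp_def del: set_upt)
qed

definition rotate_braid :: "nat \<Rightarrow> braid \<Rightarrow> braid" where
  "rotate_braid n \<beta> = ascending n (Suc 0) n \<otimes>\<^bsub>braid_group n\<^esub> \<beta> \<otimes>\<^bsub>braid_group n\<^esub>
     inv\<^bsub>braid_group n\<^esub> ascending n (Suc 0) n"

lemma rotate_braid_mult:
  assumes "\<beta> \<in> carrier (braid_group n)" "\<gamma> \<in> carrier (braid_group n)"
  shows "rotate_braid n (\<beta> \<otimes>\<^bsub>braid_group n\<^esub> \<gamma>) =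
    rotate_braid n \<beta> \<otimes>\<^bsub>braid_group n\<^esub> rotate_braid n \<gamma>"
proof -
  interpret group "braid_group n" by (rule group_braid_group)
  let ?d = "ascending n (Suc 0) n"
  have "inv\<^bsub>braid_group n\<^esub> ?d \<otimes>\<^bsub>braid_group n\<^esub> (?d \<otimes>\<^bsub>braid_group n\<^esub> X) = X"
    if "X \<in> carrier (braid_group n)" for X
    using that by (simp add: m_assoc[symmetric])
  then show ?thesis using assms by (simp add: rotate_braid_def m_assoc)
qed

lemma rotate_braid_carrier [simp]:
  "\<beta> \<in> carrier (braid_group n) \<Longrightarrow> rotate_braid n \<beta> \<in> carrier (braid_group n)"
proof -
  interpret group "braid_group n" by (rule group_braid_group)
  show "\<beta> \<in> carrier (braid_group n) \<Longrightarrow> rotate_braid n \<beta> \<in> carrier (braid_group n)"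
    by (simp add: rotate_braid_def)
qed

lemma group_hom_rotate_braid: "group_hom (braid_group n) (braid_group n) (rotate_braid n)"
  by (intro group_hom.intro group_hom_axioms.intro group_braid_group homI)
     (auto simp: rotate_braid_mult)

lemma rotate_ascending:
  assumes "1 \<le> p" "p \<le> q" "q < n"
  shows "rotate_braid n (ascending n p q) = ascending n (Suc p) (Suc q)"
proof -
  interpret group "braid_group n" by (rule group_braid_group)
  show ?thesis
    using assms by (simp add: rotate_braid_def ascending_shift[OF assms]) (simp add: m_assoc)
qed

lemma rotate_gen_Band:
  assumes "1 \<le> p" "p < q" "q \<le> n"
  shows "rotate_gen n (Band p q) = (if q = n then Band 1 (Suc p) else Band (Suc p) (Suc q))"
  using assms by (auto simp: cyc_def Let_def)

text \<open>
  Write \<open>\<delta> = \<sigma>\<^sub>1 \<cdots> \<sigma>\<^bsub>n-1\<^esub>\<close> and \<open>A\<^bsub>p,q\<^esub> = \<sigma>\<^sub>p \<cdots> \<sigma>\<^bsub>q-1\<^esub>\<close>. Conjugation by \<open>\<delta>\<close> shifts the indices of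
  \<open>A\<^bsub>p,q\<^esub>\<close> only if \<open>q < n\<close>. For \<open>q = n\<close>, substitute \<open>A\<^bsub>p,n\<^esub> = A\<^bsub>1,p\<^esub>\<inverse> \<delta>\<close> and
  \<open>\<delta> = A\<^bsub>1,p+1\<^esub> A\<^bsub>p+1,n\<^esub>\<close>, and use that \<open>A\<^bsub>p+1,n\<^esub>\<close> commutes with \<open>A\<^bsub>1,p\<^esub>\<close>.
\<close>

lemma gen_braid_rotate_gen:
  assumes "g \<in> gens n Dual"
  shows "gen_braid n (rotate_gen n g) = rotate_braid n (gen_braid n g)"
proof -
  interpret group "braid_group n" by (rule group_braid_group)
  interpret R: group_hom "braid_group n" "braid_group n" "rotate_braid n"
    by (rule group_hom_rotate_braid)
  obtain p q where g: "g = Band p q" and pq: "1 \<le> p" "p < q" "q \<le> n"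
    using assms by auto
  have rot: "rotate_braid n (gen_braid n g) =
      rotate_braid n (ascending n p q) \<otimes>\<^bsub>braid_group n\<^esub>
      inv\<^bsub>braid_group n\<^esub> ascending n (Suc p) q"
    using pq rotate_ascending[of p "q - 1" n] by (simp add: g gen_braid_Band del: gen_braid.simps)
  show ?thesis
  proof (cases "q = n")
    case False
    then show ?thesis
      using pq by (simp add: rot rotate_ascending g rotate_gen_Band gen_braid_Band del: gen_braid.simps rotate_gen.simps)
  next
    case True
    let ?d = "ascending n (Suc 0) n" and ?A = "ascending n (Suc 0) p" and ?B = "ascending n (Suc 0) (Suc p)"
      and ?C = "ascending n (Suc p) n"
    have carr: "?d \<in> carrier (braid_group n)" "?A \<in> carrier (braid_group n)"
        "?B \<in> carrier (braid_group n)" "?C \<in> carrier (braid_group n)"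
      using pq True by auto
    have "ascending n p n = inv\<^bsub>braid_group n\<^esub> ?A \<otimes>\<^bsub>braid_group n\<^esub> ?d"
      using pq True ascending_mult[of "Suc 0" p n n] carr by (simp add: inv_solve_left)
    then have "rotate_braid n (ascending n p n) = ?d \<otimes>\<^bsub>braid_group n\<^esub> inv\<^bsub>braid_group n\<^esub> ?A"
      using carr by (simp add: rotate_braid_def m_assoc)
    also have "?d = ?B \<otimes>\<^bsub>braid_group n\<^esub> ?C"
      using pq True by (simp add: ascending_mult)
    finally have "rotate_braid n (ascending n p n) =
        ?B \<otimes>\<^bsub>braid_group n\<^esub> (?C \<otimes>\<^bsub>braid_group n\<^esub> inv\<^bsub>braid_group n\<^esub> ?A)"
      using carr by (simp add: m_assoc)
    moreover have "?C \<otimes>\<^bsub>braid_group n\<^esub> inv\<^bsub>braid_group n\<^esub> ?A =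
        inv\<^bsub>braid_group n\<^esub> ?A \<otimes>\<^bsub>braid_group n\<^esub> ?C"
      using pq True carr ascending_commute[of "Suc 0" p "Suc p" n n] by (intro commute_inv) auto
    ultimately show ?thesis
      unfolding rot using True pq carr
      by (simp add: g rotate_gen_Band gen_braid_Band m_assoc del: gen_braid.simps rotate_gen.simps)
  qed
qed

lemma image_rotate_gen: "rotate_gen n ` gens n Dual = gens n Dual"
proof
  show "rotate_gen n ` gens n Dual \<subseteq> gens n Dual"
    by (auto simp: rotate_gen_Band simp del: rotate_gen.simps)
  show "gens n Dual \<subseteq> rotate_gen n ` gens n Dual"
  proof
    fix g assume "g \<in> gens n Dual"
    then obtain p q where g: "g = Band p q" and pq: "1 \<le> p" "p < q" "q \<le> n" by auto
    show "g \<in> rotate_gen n ` gens n Dual"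
    proof (cases "p = 1")
      case True
      then show ?thesis
        using g pq by (intro image_eqI[of _ _ "Band (q - 1) n"]) (auto simp: rotate_gen_Band simp del: rotate_gen.simps)
    next
      case False
      then show ?thesis
        using g pq by (intro image_eqI[of _ _ "Band (p - 1) (q - 1)"]) (auto simp: rotate_gen_Band simp del: rotate_gen.simps)
    qed
  qed
qed

lemma word_braid_phi_word:
  "w \<in> words n Dual \<Longrightarrow> word_braid n (phi_word n w) = rotate_braid n (word_braid n w)"
proof (induction w)
  interpret R: group_hom "braid_group n" "braid_group n" "rotate_braid n"
    by (rule group_hom_rotate_braid)
  {
    case Nil
    then show ?case by (simp add: phi_word_def)
  next
    case (Cons x w)
    obtain g e where x: "x = (g, e)" by force
    have g: "g \<in> gens n Dual" and w: "w \<in> words n Dual"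
      using Cons.prems x by (auto simp del: gens.simps)
    have "letter_braid n (apfst (rotate_gen n) x) = rotate_braid n (letter_braid n x)"
      by (simp add: x letter_braid_def gen_braid_rotate_gen[OF g] gen_braid_carrier[OF g])
    moreover have "letter_braid n x \<in> carrier (braid_group n)"
      using letter_braid_carrier[of x n Dual] g x by blast
    ultimately show ?case
      using Cons.IH[OF w] word_braid_carrier[OF w] by (simp add: phi_word_def)
  }
qed

lemma braid_symmetry_phi: "braid_symmetry n Dual (phi_word n) (rotate_braid n)"
proof
  interpret group "braid_group n" by (rule group_braid_group)
  have "apfst (rotate_gen n) ` (gens n Dual \<times> (UNIV :: bool set)) = gens n Dual \<times> UNIV"
    using image_rotate_gen[of n] by (auto simp: apfst_def map_prod_surj_on simp del: gens.simps)
  then show "phi_word n ` words n Dual = words n Dual"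
    unfolding words_def phi_word_def by (metis lists_image)
  show "inj_on (rotate_braid n) (carrier (braid_group n))"
    by (rule inj_onI) (simp add: rotate_braid_def)
  show "template n (rotate_braid n \<beta>) = template n (rotate_braid n \<gamma>) \<longleftrightarrow> template n \<beta> = template n \<gamma>"
    if "\<beta> \<in> carrier (braid_group n)" "\<gamma> \<in> carrier (braid_group n)" for \<beta> \<gamma>
    using that by (simp add: rotate_braid_def template_conj_eq_iff)
qed (simp_all add: word_braid_phi_word, simp add: phi_word_def)


section \<open>Orbits and reduced templates\<close>

lemma symmetry_gensE:
  assumes "g \<in> symmetry_gens n S"
  obtains \<mu> M where "g = induced n S \<mu>" "braid_symmetry n S \<mu> M"
  using assms braid_symmetry_inv[of n] braid_symmetry_theta[of n] braid_symmetry_Phi[of n]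
    braid_symmetry_phi[of n]
  by (cases S) auto

lemma subgroup_symmetries: "subgroup (symmetries n S) (BijGroup (templates n))"
  unfolding symmetries_def
proof (rule group.generate_is_subgroup[OF group_BijGroup])
  show "symmetry_gens n S \<subseteq> carrier (BijGroup (templates n))"
    by (auto simp: BijGroup_def braid_symmetry.induced_Bij elim!: symmetry_gensE)
qed

lemma symmetries_Bij: "g \<in> symmetries n S \<Longrightarrow> g \<in> Bij (templates n)"
  using subgroup.mem_carrier[OF subgroup_symmetries] by (fastforce simp: BijGroup_def)

lemma symmetry_templates: "g \<in> symmetries n S \<Longrightarrow> t \<in> templates n \<Longrightarrow> g t \<in> templates n"
  using symmetries_Bij Bij_imp_funcset by blast

lemma symmetries_compose:
  assumes "g \<in> symmetries n S" "h \<in> symmetries n S"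
  shows "compose (templates n) g h \<in> symmetries n S"
  using subgroup.m_closed[OF subgroup_symmetries assms] symmetries_Bij[OF assms(1)] symmetries_Bij[OF assms(2)]
  by (simp add: BijGroup_def)

lemma symmetries_inverse:
  assumes "g \<in> symmetries n S"
  shows "(\<lambda>t\<in>templates n. inv_into (templates n) g t) \<in> symmetries n S"
  using subgroup.m_inv_closed[OF subgroup_symmetries assms] symmetries_Bij[OF assms]
  by (simp add: inv_BijGroup)

lemma card_braids_of_symmetry:
  assumes "g \<in> symmetries n S" "t \<in> templates n"
  shows "card (braids_of_template n S l (g t)) = card (braids_of_template n S l t)"
proof -
  let ?c = "\<lambda>t. card (braids_of_template n S l t)"
  have gens: "h \<in> Bij (templates n) \<and> (\<forall>t\<in>templates n. ?c (h t) = ?c t)"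
    if "h \<in> symmetry_gens n S" for h
    using that braid_symmetry.induced_Bij braid_symmetry.card_braids_of_induced_template
    by (fastforce elim!: symmetry_gensE)
  have "g \<in> Bij (templates n) \<and> (\<forall>t\<in>templates n. ?c (g t) = ?c t)"
    using assms(1) unfolding symmetries_def
  proof (induction rule: generate.induct)
    case one
    have one: "\<one>\<^bsub>BijGroup (templates n)\<^esub> = (\<lambda>t\<in>templates n. t)"
      by (simp only: BijGroup_def monoid.simps)
    show ?case unfolding one by (intro conjI id_Bij) simp
  next
    case (incl h)
    then show ?case by (rule gens)
  next
    case (inv h)
    then have h: "h \<in> Bij (templates n)" and c: "\<And>t. t \<in> templates n \<Longrightarrow> ?c (h t) = ?c t"
      using gens by blast+
    have "?c (inv_into (templates n) h t) = ?c t" if "t \<in> templates n" for t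
      using c[OF Bij_inv_into_mem[OF h that]] h that
      by (simp add: Bij_def bij_betw_def f_inv_into_f)
    then show ?case
      unfolding inv_BijGroup[OF h] by (intro conjI restrict_inv_into_Bij[OF h]) simp
  next
    case (eng g h)
    then have "h t \<in> templates n" if "t \<in> templates n" for t
      using that Bij_imp_funcset by blast
    then show ?case using eng by (simp add: BijGroup_def compose_Bij compose_eq)
  qed
  then show ?thesis using assms(2) by blast
qed

lemma template_orbit_self: "t \<in> templates n \<Longrightarrow> t \<in> template_orbit n S t"
  using subgroup.one_closed[OF subgroup_symmetries[of n S]]
  by (auto simp: template_orbit_def BijGroup_def intro!: exI[of _ "\<lambda>x\<in>templates n. x"])

lemma template_orbit_subset: "t \<in> templates n \<Longrightarrow> template_orbit n S t \<subseteq> templates n"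
  by (auto simp: template_orbit_def symmetry_templates)

lemma template_orbit_eq:
  assumes "t \<in> templates n" "u \<in> template_orbit n S t"
  shows "template_orbit n S u = template_orbit n S t"
proof -
  have sub: "template_orbit n S (g t) \<subseteq> template_orbit n S t"
    if "t \<in> templates n" "g \<in> symmetries n S" for g t
  proof
    fix v assume "v \<in> template_orbit n S (g t)"
    then obtain h where "h \<in> symmetries n S" "v = h (g t)"
      by (auto simp: template_orbit_def)
    then have "h \<in> symmetries n S" "v = compose (templates n) h g t"
      using that by (simp_all add: compose_eq)
    then show "v \<in> template_orbit n S t"
      using symmetries_compose that(2) by (auto simp: template_orbit_def)
  qed
  obtain g where g: "g \<in> symmetries n S" "u = g t" using assms by (auto simp: template_orbit_def)
  let ?h = "\<lambda>t\<in>templates n. inv_into (templates n) g t"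
  have u: "u \<in> templates n" using g assms(1) by (simp add: symmetry_templates)
  have "?h u = t"
    using symmetries_Bij[OF g(1)] g(2) assms(1) u by (simp add: Bij_def bij_betw_def inv_into_f_f)
  then show ?thesis
    using sub[OF assms(1) g(1)] sub[OF u symmetries_inverse[OF g(1)]] g(2) by auto
qed

lemma templates_of_length_iff:
  "t \<in> templates_of_length n S l \<longleftrightarrow> card (braids_of_template n S l t) \<noteq> 0"
proof -
  have "finite (braids_of_template n S l t)"
    by (rule finite_subset[OF _ finite_braids_of_length[of n S l]]) (auto simp: braids_of_template_def)
  then show ?thesis
    by (auto simp: templates_of_length_def braids_of_template_def)
qed

lemma templates_of_length_subset: "templates_of_length n S l \<subseteq> templates n"
  by (auto simp: templates_of_length_def braids_of_length_def templates_def)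

lemma template_orbit_subset_of_length:
  assumes "t \<in> templates_of_length n S l"
  shows "template_orbit n S t \<subseteq> templates_of_length n S l"
proof
  fix u assume "u \<in> template_orbit n S t"
  then show "u \<in> templates_of_length n S l"
    using assms subsetD[OF templates_of_length_subset assms]
    by (auto simp: template_orbit_def templates_of_length_iff card_braids_of_symmetry)
qed

lemma finite_template_orbit:
  "t \<in> templates_of_length n S l \<Longrightarrow> finite (template_orbit n S t)"
  using template_orbit_subset_of_length finite_braids_of_length
  by (metis finite_imageI finite_subset templates_of_length_def)

lemma perm_less_trans: "perm_less n f g \<Longrightarrow> perm_less n g h \<Longrightarrow> perm_less n f h"
proof -
  assume "perm_less n f g" "perm_less n g h"
  then obtain k l where k: "k \<in> {1..n}" "\<forall>m\<in>{k<..n}. f m = g m" "f k < g k"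
    and l: "l \<in> {1..n}" "\<forall>m\<in>{l<..n}. g m = h m" "g l < h l"
    by (auto simp: perm_less_def)
  have "f (max k l) < h (max k l)"
  proof (cases k l rule: linorder_cases)
    case less
    then show ?thesis using k(2) l by simp
  next
    case equal
    then show ?thesis using k(3) l(3) by simp
  next
    case greater
    then show ?thesis using l(2) k by simp
  qed
  moreover have "\<forall>m\<in>{max k l<..n}. f m = h m" using k(2) l(2) by simp
  moreover have "max k l \<in> {1..n}" using k(1) l(1) by (simp add: max_def)
  ultimately show ?thesis unfolding perm_less_def by blast
qed

lemma perm_less_linear:
  assumes "f \<noteq> g" "\<And>k. k \<notin> {1..n} \<Longrightarrow> f k = g k"
  shows "perm_less n f g \<or> perm_less n g f"
proof -
  let ?D = "{k. f k \<noteq> g k}"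
  have D: "?D \<subseteq> {1..n}" "?D \<noteq> {}" using assms by auto
  then have fin: "finite ?D" using finite_subset by blast
  obtain k where k: "k \<in> {1..n}" "f k \<noteq> g k" "\<And>m. k < m \<Longrightarrow> f m = g m"
  proof
    show "Max ?D \<in> {1..n}" "f (Max ?D) \<noteq> g (Max ?D)"
      using Max_in[OF fin D(2)] D(1) by blast+
    show "f m = g m" if "Max ?D < m" for m
      using Max_ge[OF fin, of m] that by (meson mem_Collect_eq not_le)
  qed
  then have above: "\<forall>m\<in>{k<..n}. f m = g m" "\<forall>m\<in>{k<..n}. g m = f m" by simp_all
  show ?thesis
    using k(1,2) above unfolding perm_less_def by (metis linorder_neqE_nat)
qed

lemma template_less_irrefl: "\<not> template_less n t t"
  by (auto simp: template_less_def perm_less_def lexord_irreflexive)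

lemma template_less_trans:
  assumes "template_less n t u" "template_less n u v"
  shows "template_less n t v"
proof -
  have "trans {(x, y :: int). x < y}" by (auto simp: trans_def)
  then show ?thesis
    using assms perm_less_trans lexord_trans by (fastforce simp: template_less_def)
qed

lemma template_less_linear:
  assumes "t \<in> templates n" "u \<in> templates n" "t \<noteq> u"
  shows "template_less n t u \<or> template_less n u t"
proof -
  have outside: "fst t k = k" if t: "t \<in> templates n" and k: "k \<notin> {1..n}" for t k
  proof -
    obtain w where "w \<in> artin_words n" "t = template n (braid_class n w)"
      using t by (auto simp: templates_def carrier_braid_group)
    then show ?thesis
      using k by (simp add: template_def braid_perm_class word_perm_outside)
  qed
  show ?thesis
  proof (cases "fst t = fst u")
    case True
    then have "snd t \<noteq> snd u" using assms(3) by (simp add: prod_eq_iff)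
    moreover have "total {(x, y :: int). x < y}" by (auto simp: total_on_def)
    ultimately show ?thesis
      using True total_lexord[of "{(x, y :: int). x < y}"]
      by (auto simp: template_less_def total_on_def)
  next
    case False
    then show ?thesis
      using perm_less_linear[of "fst t" "fst u" n] outside assms by (auto simp: template_less_def)
  qed
qed

lemma finite_ex_least_template:
  assumes "finite A" "A \<noteq> {}" "A \<subseteq> templates n"
  shows "\<exists>u\<in>A. \<forall>v\<in>A. v = u \<or> template_less n u v"
  using assms
proof (induction rule: finite_ne_induct)
  case (insert t A)
  then obtain u where u: "u \<in> A" "\<forall>v\<in>A. v = u \<or> template_less n u v" by auto
  have "template_less n t u \<or> template_less n u t"
    using insert.hyps insert.prems u(1) by (intro template_less_linear) auto
  then show ?case
  proof
    assume "template_less n t u"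
    then have "\<forall>v\<in>insert t A. v = t \<or> template_less n t v"
      using u template_less_trans[of n t u] by (metis insert_iff)
    then show ?thesis by blast
  next
    assume "template_less n u t"
    then show ?thesis using u by blast
  qed
qed auto

lemma red_in_orbit:
  assumes "t \<in> templates_of_length n S l"
  shows "red n S t \<in> template_orbit n S t"
proof -
  let ?least = "\<lambda>u. u \<in> template_orbit n S t \<and>
    (\<forall>v\<in>template_orbit n S t. v = u \<or> template_less n u v)"
  have t: "t \<in> templates n" using assms templates_of_length_subset by blast
  obtain u where "?least u"
    using finite_ex_least_template[OF finite_template_orbit[OF assms] _ template_orbit_subset[OF t]]
      template_orbit_self[OF t] by blast
  moreover have "v = u" if "?least v" for v
    using that \<open>?least u\<close> template_less_trans[of n u v u] template_less_irrefl[of n u] by metis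
  ultimately show ?thesis
    unfolding red_def using theI[of ?least u] by blast
qed

lemma red_orbit:
  assumes "t \<in> templates n" "u \<in> template_orbit n S t"
  shows "red n S u = red n S t"
  by (simp add: red_def template_orbit_eq[OF assms])

lemma red_eq_iff:
  assumes "t \<in> templates_of_length n S l" "r \<in> reduced_templates n S l"
  shows "red n S t = r \<longleftrightarrow> t \<in> template_orbit n S r"
proof -
  have t: "t \<in> templates n" and r: "r \<in> templates n" "red n S r = r"
    using assms templates_of_length_subset by (auto simp: reduced_templates_def)
  show ?thesis
    using red_in_orbit[OF assms(1)] template_orbit_eq[OF t] template_orbit_self[OF t] red_orbit[OF r(1)] r(2)
    by metis
qed

theorem corollary5p21:
  fixes n l :: nat and S :: alphabet
  assumes "n \<ge> 2"
  shows "num_braids n S l =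
    (\<Sum>t\<in>reduced_templates n S l.
       card (braids_of_template n S l t) * card (template_orbit n S t))"
proof -
  let ?T = "templates_of_length n S l" and ?R = "reduced_templates n S l"
  let ?c = "\<lambda>t. card (braids_of_template n S l t)"
  have finT: "finite ?T"
    using finite_braids_of_length by (simp add: templates_of_length_def)
  have finR: "finite ?R"
    using finT by (simp add: reduced_templates_def)
  have "num_braids n S l = (\<Sum>\<beta>\<in>braids_of_length n S l. 1)"
    by (simp add: num_braids_def)
  also have "\<dots> = (\<Sum>t\<in>?T. \<Sum>\<beta>\<in>braids_of_template n S l t. 1)"
    unfolding braids_of_template_def
    by (rule sum.group[symmetric]) (auto simp: finT finite_braids_of_length templates_of_length_def)
  also have "\<dots> = (\<Sum>t\<in>?T. ?c t)" by simp
  also have "\<dots> = (\<Sum>r\<in>?R. \<Sum>t\<in>{t\<in>?T. red n S t = r}. ?c t)"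
  proof (rule sum.group[symmetric, OF finT finR])
    show "red n S ` ?T \<subseteq> ?R"
    proof
      fix r assume "r \<in> red n S ` ?T"
      then obtain t where t: "t \<in> ?T" "r = red n S t" by blast
      have "t \<in> templates n" using t(1) templates_of_length_subset by blast
      then have "red n S r = r"
        using red_in_orbit[OF t(1)] red_orbit t(2) by metis
      moreover have "r \<in> ?T"
        using red_in_orbit[OF t(1)] template_orbit_subset_of_length[OF t(1)] t(2) by blast
      ultimately show "r \<in> ?R" by (simp add: reduced_templates_def)
    qed
  qed
  also have "\<dots> = (\<Sum>r\<in>?R. ?c r * card (template_orbit n S r))"
  proof (rule sum.cong[OF HOL.refl])
    fix r assume r: "r \<in> ?R"
    then have rT: "r \<in> ?T" by (simp add: reduced_templates_def)
    then have "{t\<in>?T. red n S t = r} = template_orbit n S r"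
      using red_eq_iff[OF _ r] template_orbit_subset_of_length[OF rT] by blast
    moreover have "?c t = ?c r" if "t \<in> template_orbit n S r" for t
      using that rT templates_of_length_subset[of n S l]
      by (auto simp: template_orbit_def card_braids_of_symmetry)
    ultimately show "(\<Sum>t\<in>{t\<in>?T. red n S t = r}. ?c t) = ?c r * card (template_orbit n S r)"
      by simp
  qed
  finally show ?thesis .
qed

end
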